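(* Let $G$ be a finite connected graph, $\Gamma$ a finite abelian group, and $\phi\colon V(G)\to\Gamma$ an isometric embedding of $G$ into $\mathrm{Cay}(\Gamma,S)$. Fix a generator $g\in S$. Then the set of edges of $G$ carrying $g$, taken with their forward orientations, has in-degree at most $1$ and out-degree at most $1$ at every vertex of $G$. Equivalently, every generator class is a partial permutation: a disjoint union of directed paths and directed cycles.
   Context: For a finite abelian group $\Gamma$ and a generating set $S\subseteq\Gamma\setminus\{0\}$ with $S=-S$, the Cayley graph $\mathrm{Cay}(\Gamma,S)$ has vertex set $\Gamma$ and an edge $\{h,h+s\}$ for each $h\in\Gamma$, $s\in S$; $d_\Gamma$ is its graph metric. An isometric embedding of $G$ into $\mathrm{Cay}(\Gamma,S)$ is an injection $\phi\colon V(G)\to\Gamma$ with $d_\Gamma(\phi(u),\phi(v))=d_G(u,v)$ for all $u,v$, where $d_G$ is the shortest-path metric. An edge $\{u,v\}$ of $G$ carries the generator $g$ if $\phi(v)-\phi(u)=\pm g$; its forward orientation is $u\to v$ when $\phi(v)-\phi(u)=g$ (if $g=-g$, either orientation is a forward orientation). The generator class of $g$ is the set of edges carrying $g$, with forward orientations. *)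

theory Defs
  imports
    "Graph_Theory.Graph_Theory"
    "HOL-Computational_Algebra.Group_Closure"
begin

text \<open>
  A finite simple graph is a \<^locale>\<open>pair_graph\<close>: the undirected edge joining
  \<open>u\<close> and \<open>v\<close> is the pair of arcs \<open>(u, v)\<close>, \<open>(v, u)\<close>.
\<close>

definition graph_dist :: "'v pair_pre_digraph \<Rightarrow> 'v \<Rightarrow> 'v \<Rightarrow> ereal" where
  "graph_dist G u v = wf_digraph.\<mu> (with_proj G) (\<lambda>_. 1) u v"

definition connection_set :: "'g::ab_group_add set \<Rightarrow> bool" where
  "connection_set S \<longleftrightarrow> 0 \<notin> S \<and> uminus ` S = S \<and> group_closure S = UNIV"

text \<open>The Cayley graph is only used for a \<^const>\<open>connection_set\<close> \<open>S\<close>; its arc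
  set is then symmetric and loop-free.\<close>

definition cayley_graph :: "'g::ab_group_add set \<Rightarrow> 'g pair_pre_digraph" where
  "cayley_graph S = \<lparr> pverts = UNIV, parcs = {(h, h + s) | h s. s \<in> S} \<rparr>"

definition isometric_embedding ::
    "'v pair_pre_digraph \<Rightarrow> 'w pair_pre_digraph \<Rightarrow> ('v \<Rightarrow> 'w) \<Rightarrow> bool" where
  "isometric_embedding G H \<phi> \<longleftrightarrow>
     \<phi> ` pverts G \<subseteq> pverts H \<and> inj_on \<phi> (pverts G) \<and>
     (\<forall>u \<in> pverts G. \<forall>v \<in> pverts G. graph_dist H (\<phi> u) (\<phi> v) = graph_dist G u v)"

definition carries :: "('v \<Rightarrow> 'g::ab_group_add) \<Rightarrow> 'g \<Rightarrow> 'v \<Rightarrow> 'v \<Rightarrow> bool" where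
  "carries \<phi> g u v \<longleftrightarrow> \<phi> v - \<phi> u = g \<or> \<phi> v - \<phi> u = - g"

definition forward :: "('v \<Rightarrow> 'g::ab_group_add) \<Rightarrow> 'g \<Rightarrow> 'v \<Rightarrow> 'v \<Rightarrow> bool" where
  "forward \<phi> g u v \<longleftrightarrow> \<phi> v - \<phi> u = g"

text \<open>
  \<open>D\<close> consists of the edges of \<open>G\<close> carrying \<open>g\<close>, each taken with a forward orientation.
  If \<open>g \<noteq> - g\<close>, then \<open>D\<close> is uniquely determined.  If \<open>g = - g\<close>, both orientations of
  an edge are forward, and \<open>D\<close> may contain either one of them, or both.
\<close>

definition generator_class ::
    "'v pair_pre_digraph \<Rightarrow> ('v \<Rightarrow> 'g::ab_group_add) \<Rightarrow> 'g \<Rightarrow> 'v pair_pre_digraph \<Rightarrow> bool" where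
  "generator_class G \<phi> g D \<longleftrightarrow>
     pverts D = pverts G \<and>
     (\<forall>(u, v) \<in> parcs D. (u, v) \<in> parcs G \<and> carries \<phi> g u v \<and> forward \<phi> g u v) \<and>
     (\<forall>(u, v) \<in> parcs G. carries \<phi> g u v \<longrightarrow> (u, v) \<in> parcs D \<or> (v, u) \<in> parcs D)"

definition partial_permutation_on :: "'v set \<Rightarrow> 'v rel \<Rightarrow> bool" where
  "partial_permutation_on V R \<longleftrightarrow> R \<subseteq> V \<times> V \<and> single_valued R \<and> single_valued (R\<inverse>)"

text \<open>A single vertex without arcs is a directed path (of length 0).\<close>

definition directed_path :: "'v pair_pre_digraph \<Rightarrow> bool" where
  "directed_path P \<longleftrightarrow>
     (\<exists>u p v. pre_digraph.apath (with_proj P) u p v \<and>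
        pverts P = set (pawalk_verts u p) \<and> parcs P = set p)"

definition directed_cycle :: "'v pair_pre_digraph \<Rightarrow> bool" where
  "directed_cycle C \<longleftrightarrow>
     (\<exists>p. pre_digraph.cycle (with_proj C) p \<and> pverts C = fst ` set p \<and> parcs C = set p)"

definition disjoint_union_of_paths_and_cycles :: "'v pair_pre_digraph \<Rightarrow> bool" where
  "disjoint_union_of_paths_and_cycles D \<longleftrightarrow>
     (\<exists>\<C>. (\<forall>C \<in> \<C>. directed_path C \<or> directed_cycle C) \<and>
        pairwise (\<lambda>C C'. disjnt (pverts C) (pverts C')) \<C> \<and>
        pverts D = (\<Union>C \<in> \<C>. pverts C) \<and> parcs D = (\<Union>C \<in> \<C>. parcs C))"

end

theory Submission
  imports Defs
begin

text \<open>
  Along a forward arc the label \<open>\<phi>\<close> increases by \<open>g\<close>, so injectivity of \<open>\<phi>\<close> alone determines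
  both the successor and the predecessor of a vertex.  That a finite partial permutation splits
  into paths and cycles follows by adding its arcs one at a time: a new arc starts at the end of
  one path and ends at the start of another path, which it joins, or of the same path, which it
  closes to a cycle.
\<close>

lemma awalk_pair_iff:
  "pre_digraph.awalk (with_proj G) u p v \<longleftrightarrow> u \<in> pverts G \<and> set p \<subseteq> parcs G \<and> pcas u p v"
  by (simp add: pre_digraph.awalk_def cas_with_proj_eq)

lemma pcas_append: "pcas u p v \<Longrightarrow> pcas v q w \<Longrightarrow> pcas u (p @ q) w"
  by (induction p arbitrary: u) auto

text \<open>The vertex list of a walk is read in two ways, by tails here and by heads in the next
  lemma. On a path the first reading singles out the end as the vertex without outgoing arc, the
  second the start as the one without incoming arc.\<close>

lemma pawalk_verts_eq_fst: "pcas u p v \<Longrightarrow> pawalk_verts u p = map fst p @ [v]"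
  by (induction p arbitrary: u) auto

lemma pawalk_verts_eq_snd: "pcas u p v \<Longrightarrow> pawalk_verts u p = u # map snd p"
  by (induction p arbitrary: u) auto

lemma pawalk_verts_append: "pcas u p v \<Longrightarrow> pawalk_verts u (p @ q) = map fst p @ pawalk_verts v q"
  by (induction p arbitrary: u) auto

text \<open>The membership conditions in \<open>awalk\<close> follow from the two equations for
  \<open>pverts P\<close> and \<open>parcs P\<close>, so only \<open>pcas\<close> and distinctness
  remain.\<close>

lemma directed_path_iff:
  "directed_path P \<longleftrightarrow> (\<exists>u p v. pcas u p v \<and> distinct (pawalk_verts u p) \<and>
     pverts P = set (pawalk_verts u p) \<and> parcs P = set p)"
proof -
  have "u \<in> set (pawalk_verts u p)" if "pcas u p v" for u v :: 'a and p
    using pawalk_verts_eq_snd[OF that] by simp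
  then show ?thesis
    unfolding directed_path_def pre_digraph.apath_def awalk_pair_iff awalk_verts_with_proj_eq
    by (intro iff_exI) auto
qed

text \<open>Both readings of the vertex list contain \<open>u\<close> once in addition, at the front
  or at the back; cancelling it leaves heads and tails.\<close>

lemma closed_walk_mset_snd:
  assumes "pcas u p u"
  shows "mset (map snd p) = mset (map fst p)"
proof -
  have "u # map snd p = map fst p @ [u]"
    using pawalk_verts_eq_fst[OF assms] pawalk_verts_eq_snd[OF assms] by simp
  then have "mset (u # map snd p) = mset (map fst p @ [u])"
    by (rule arg_cong)
  then show ?thesis
    by simp
qed

text \<open>\<open>cycle\<close> asks for distinct heads. Distinct tails are equivalent on a closed
  walk, and they suit a path closed by one arc: its tails are the vertices of the path.\<close>

lemma directed_cycle_iff: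
  "directed_cycle C \<longleftrightarrow> (\<exists>p u. pcas u p u \<and> distinct (map fst p) \<and> p \<noteq> [] \<and>
     pverts C = fst ` set p \<and> parcs C = set p)"
proof -
  have dist: "distinct (tl (pawalk_verts u p)) \<longleftrightarrow> distinct (map fst p)" if "pcas u p u"
    for u :: 'a and p
    using mset_eq_imp_distinct_iff[OF closed_walk_mset_snd[OF that]]
    by (simp add: pawalk_verts_eq_snd[OF that])
  have start: "u \<in> fst ` set p" if "pcas u p u" "p \<noteq> []" for u :: 'a and p
    using that by (cases p) auto
  show ?thesis
    unfolding directed_cycle_def pre_digraph.cycle_def awalk_pair_iff awalk_verts_with_proj_eq
    \<comment> \<open>The equations for \<open>C\<close> move under the inner quantifier, so that
      both sides are compared for fixed \<open>p\<close> and \<open>u\<close>.\<close>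
    unfolding ex_simps(1)[symmetric] using dist start by (intro iff_exI) auto
qed

lemma directed_cycle_snd:
  assumes "directed_cycle C"
  shows "pverts C = snd ` parcs C"
proof -
  obtain u p where p: "pcas u p u" "pverts C = fst ` set p" "parcs C = set p"
    using assms unfolding directed_cycle_iff by blast
  show ?thesis
    using mset_eq_setD[OF closed_walk_mset_snd[OF p(1)]] p(2,3) by simp
qed

text \<open>Every vertex of a cycle is the tail of an arc, so \<open>C\<close> is a path, and
  \<open>u\<close> can only be its end.\<close>

lemma path_or_cycle_ends_at:
  assumes "directed_path C \<or> directed_cycle C" "u \<in> pverts C" "u \<notin> fst ` parcs C"
  obtains a p where "pcas a p u" "distinct (pawalk_verts a p)"
    "pverts C = set (pawalk_verts a p)" "parcs C = set p"
proof -
  have "\<not> directed_cycle C"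
    using assms(2,3) unfolding directed_cycle_iff by auto
  then obtain a p b where p: "pcas a p b" "distinct (pawalk_verts a p)"
      "pverts C = set (pawalk_verts a p)" "parcs C = set p"
    using assms(1) unfolding directed_path_iff by blast
  moreover have "b = u"
    using assms(2,3) p pawalk_verts_eq_fst[OF p(1)] by auto
  ultimately show thesis
    using that by blast
qed

text \<open>The mirror image, with heads in place of tails; \<open>directed_cycle_snd\<close>
  excludes the cycle.\<close>

lemma path_or_cycle_starts_at:
  assumes "directed_path C \<or> directed_cycle C" "v \<in> pverts C" "v \<notin> snd ` parcs C"
  obtains q d where "pcas v q d" "distinct (pawalk_verts v q)"
    "pverts C = set (pawalk_verts v q)" "parcs C = set q"
proof -
  have "\<not> directed_cycle C"
    using assms(2,3) directed_cycle_snd by blast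
  then obtain c q d where q: "pcas c q d" "distinct (pawalk_verts c q)"
      "pverts C = set (pawalk_verts c q)" "parcs C = set q"
    using assms(1) unfolding directed_path_iff by blast
  moreover have "c = v"
    using assms(2,3) q pawalk_verts_eq_snd[OF q(1)] by auto
  ultimately show thesis
    using that by blast
qed

text \<open>This is the induction step of the decomposition. Disjointness is conditional because
  \<open>C\<close> and \<open>C'\<close> may be the same path, which the new arc then
  closes.\<close>

lemma join_paths:
  assumes C: "directed_path C \<or> directed_cycle C" "u \<in> pverts C" "u \<notin> fst ` parcs C"
    and C': "directed_path C' \<or> directed_cycle C'" "v \<in> pverts C'" "v \<notin> snd ` parcs C'"
    and disj: "C \<noteq> C' \<Longrightarrow> disjnt (pverts C) (pverts C')"
  obtains N where "directed_path N \<or> directed_cycle N"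
    "pverts N = pverts C \<union> pverts C'" "parcs N = insert (u, v) (parcs C \<union> parcs C')"
proof -
  obtain a p where p: "pcas a p u" "distinct (pawalk_verts a p)"
      "pverts C = set (pawalk_verts a p)" "parcs C = set p"
    using C by (rule path_or_cycle_ends_at)
  note verts_p = pawalk_verts_eq_fst[OF p(1)]
  show thesis
  proof (cases "C = C'")
    case True
    have "v = a"
      using C'(2,3) p True pawalk_verts_eq_snd[OF p(1)] by auto
    \<comment> \<open>If \<open>p\<close> is empty, then \<open>u = v\<close> and the cycle is a
      loop.\<close>
    then have "pcas v (p @ [(u, v)]) v"
      using p(1) by (intro pcas_append) auto
    moreover have "distinct (map fst (p @ [(u, v)]))"
      using p(2) verts_p by simp
    ultimately have "directed_cycle \<lparr>pverts = pverts C, parcs = insert (u, v) (parcs C)\<rparr>"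
      unfolding directed_cycle_iff using p(3,4) verts_p
      by (intro exI[of _ "p @ [(u, v)]"] exI[of _ v]) auto
    then show thesis
      using that True by force
  next
    case False
    obtain q d where q: "pcas v q d" "distinct (pawalk_verts v q)"
        "pverts C' = set (pawalk_verts v q)" "parcs C' = set q"
      using C' by (rule path_or_cycle_starts_at)
    have walk: "pcas a (p @ (u, v) # q) d"
      using p(1) q(1) by (intro pcas_append) auto
    \<comment> \<open>The tail \<open>u\<close> of the new arc supplies the end of the first path,
      which \<open>map fst p\<close> omits.\<close>
    have verts: "pawalk_verts a (p @ (u, v) # q) = pawalk_verts a p @ pawalk_verts v q"
      using pawalk_verts_append[OF p(1)] verts_p by simp
    have "distinct (pawalk_verts a (p @ (u, v) # q))"
      using p(2,3) q(2,3) disj[OF False] by (simp add: verts disjnt_def)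
    then have "directed_path \<lparr>pverts = pverts C \<union> pverts C',
        parcs = insert (u, v) (parcs C \<union> parcs C')\<rparr>"
      unfolding directed_path_iff using walk p(3,4) q(3,4) verts
      by (intro exI[of _ a] exI[of _ "p @ (u, v) # q"] exI[of _ d]) auto
    then show thesis
      using that by force
  qed
qed

lemma partial_permutation_paths_and_cycles:
  assumes "finite R" "partial_permutation_on V R"
  shows "disjoint_union_of_paths_and_cycles \<lparr>pverts = V, parcs = R\<rparr>"
  using assms
proof (induction R rule: finite_induct)
  case empty
  \<comment> \<open>Without arcs, every vertex of \<open>V\<close> is a path of length 0.\<close>
  have "directed_path \<lparr>pverts = {v}, parcs = {}\<rparr>" for v :: 'a
    unfolding directed_path_iff by (intro exI[of _ v] exI[of _ "[]"]) auto
  then show ?case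
    unfolding disjoint_union_of_paths_and_cycles_def
    by (intro exI[of _ "(\<lambda>v. \<lparr>pverts = {v}, parcs = {}\<rparr>) ` V"])
      (auto simp: pairwise_def disjnt_def)
next
  case (insert e R)
  obtain u v where e: "e = (u, v)"
    by fastforce
  have R: "partial_permutation_on V R"
    using insert.prems by (auto simp: partial_permutation_on_def single_valued_def)
  have uv: "u \<in> V" "v \<in> V"
    using insert.prems unfolding partial_permutation_on_def e by blast+
  \<comment> \<open>A second arc leaving \<open>u\<close> or entering \<open>v\<close> would have to
    equal \<open>e\<close>, which is not in \<open>R\<close>.\<close>
  have "u \<noteq> fst a" "v \<noteq> snd a" if "a \<in> R" for a
    using insert.prems insert.hyps(2) that unfolding partial_permutation_on_def e
    by (metis converseI insertCI prod.collapse single_valuedD)+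
  then have ends: "u \<notin> fst ` R" "v \<notin> snd ` R"
    by blast+
  obtain \<C> where \<C>: "\<forall>C \<in> \<C>. directed_path C \<or> directed_cycle C"
      "pairwise (\<lambda>C C'. disjnt (pverts C) (pverts C')) \<C>"
      "V = (\<Union>C \<in> \<C>. pverts C)" "R = (\<Union>C \<in> \<C>. parcs C)"
    using insert.IH[OF R]
    unfolding disjoint_union_of_paths_and_cycles_def pair_pre_digraph.select_convs by blast
  obtain C C' where C: "C \<in> \<C>" "u \<in> pverts C" and C': "C' \<in> \<C>" "v \<in> pverts C'"
    using uv unfolding \<C>(3) by blast
  have comp: "directed_path C \<or> directed_cycle C" "directed_path C' \<or> directed_cycle C'"
    using \<C>(1) C(1) C'(1) by blast+
  have disj: "disjnt (pverts C) (pverts C')" if "C \<noteq> C'"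
    using \<C>(2) C(1) C'(1) that by (rule pairwiseD)
  have "u \<notin> fst ` parcs C" "v \<notin> snd ` parcs C'"
    using ends C(1) C'(1) unfolding \<C>(4) by blast+
  with comp C(2) C'(2) disj obtain N where N: "directed_path N \<or> directed_cycle N"
      "pverts N = pverts C \<union> pverts C'" "parcs N = insert (u, v) (parcs C \<union> parcs C')"
    by (metis join_paths)
  \<comment> \<open>\<open>N\<close> replaces the components it was made from; its vertices are
    theirs, so it stays disjoint from the others.\<close>
  let ?\<D> = "insert N (\<C> - {C, C'})"
  have "pairwise (\<lambda>C C'. disjnt (pverts C) (pverts C')) ?\<D>"
    using \<C>(2) C(1) C'(1) unfolding pairwise_def
    by (auto simp: N(2) disjnt_Un1 disjnt_Un2)
  moreover have "V = (\<Union>C \<in> ?\<D>. pverts C)"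
    using C(1) C'(1) unfolding \<C>(3) UN_insert N(2) by blast
  moreover have "insert e R = (\<Union>C \<in> ?\<D>. parcs C)"
    using C(1) C'(1) unfolding \<C>(4) UN_insert N(3) e by blast
  moreover have "\<forall>C \<in> ?\<D>. directed_path C \<or> directed_cycle C"
    using \<C>(1) N(1) by auto
  ultimately show ?case
    unfolding disjoint_union_of_paths_and_cycles_def pair_pre_digraph.select_convs by blast
qed

text \<open>Arcs leaving \<open>u\<close> all end at label \<open>\<phi> u + g\<close>, and arcs
  entering \<open>v\<close> all start at \<open>\<phi> v - g\<close>. This also covers
  \<open>g = - g\<close>, where an edge taken in both orientations forms a cycle of length
  2.\<close>

lemma generator_class_partial_permutation:
  assumes "pair_wf_digraph G" "inj_on \<phi> (pverts G)" "generator_class G \<phi> g D"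
  shows "partial_permutation_on (pverts G) (parcs D)"
proof -
  have D: "(u, v) \<in> parcs G" "\<phi> v = \<phi> u + g" if "(u, v) \<in> parcs D" for u v
    using assms(3) that by (auto simp: generator_class_def forward_def algebra_simps)
  have V: "u \<in> pverts G" "v \<in> pverts G" if "(u, v) \<in> parcs D" for u v
    using D(1)[OF that] pair_wf_digraph.wellformed'[OF assms(1)] by auto
  show ?thesis
    unfolding partial_permutation_on_def
  proof (intro conjI)
    show "parcs D \<subseteq> pverts G \<times> pverts G"
      using V by auto
    show "single_valued (parcs D)"
      by (rule single_valuedI) (metis D(2) V(2) assms(2) inj_on_eq_iff)
    show "single_valued ((parcs D)\<inverse>)"
      by (rule single_valuedI) (metis D(2) V(1) assms(2) add_right_cancel converseD inj_on_eq_iff)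
  qed
qed

lemma partial_permutation_degree_le_1:
  assumes "partial_permutation_on V (parcs D)"
  shows "in_degree (with_proj D) v \<le> 1" "out_degree (with_proj D) v \<le> 1"
proof -
  have card_le_1: "card A \<le> 1" if "\<And>x y. x \<in> A \<Longrightarrow> y \<in> A \<Longrightarrow> x = y" for A :: "('a \<times> 'a) set"
    \<comment> \<open>For infinite \<open>A\<close> the bound holds because \<open>card A\<close> is
      0.\<close>
    using that by (cases "finite A") (auto simp: card_le_Suc0_iff_eq)
  show "in_degree (with_proj D) v \<le> 1"
    unfolding in_degree_def using assms
    by (intro card_le_1) (auto simp: partial_permutation_on_def single_valued_def)
  show "out_degree (with_proj D) v \<le> 1"
    unfolding out_degree_def using assms
    by (intro card_le_1) (auto simp: partial_permutation_on_def single_valued_def)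
qed

theorem proposition1:
  fixes G :: "'v pair_pre_digraph"
    and S :: "'g::{finite, ab_group_add} set"
    and \<phi> :: "'v \<Rightarrow> 'g"
    and g :: 'g
    and D :: "'v pair_pre_digraph"
  assumes "pair_graph G"
    and "connected (with_proj G)"
    and "connection_set S"
    and "isometric_embedding G (cayley_graph S) \<phi>"
    and "g \<in> S"
    and "generator_class G \<phi> g D"
  shows "(\<forall>v \<in> pverts G. in_degree (with_proj D) v \<le> 1 \<and> out_degree (with_proj D) v \<le> 1)
       \<and> partial_permutation_on (pverts G) (parcs D)
       \<and> disjoint_union_of_paths_and_cycles D"
proof -
  interpret pair_graph G
    by fact
  have perm: "partial_permutation_on (pverts G) (parcs D)"
    using assms(4,6) pair_wf_digraph_axioms
    by (intro generator_class_partial_permutation) (auto simp: isometric_embedding_def)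
  have D: "pverts D = pverts G" "parcs D \<subseteq> parcs G"
    using assms(6) by (auto simp: generator_class_def)
  then have "finite (parcs D)"
    using pair_finite_arcs finite_subset by blast
  then have "disjoint_union_of_paths_and_cycles \<lparr>pverts = pverts G, parcs = parcs D\<rparr>"
    using perm by (rule partial_permutation_paths_and_cycles)
  moreover have "\<lparr>pverts = pverts G, parcs = parcs D\<rparr> = D"
    using D(1) by simp
  ultimately show ?thesis
    using perm partial_permutation_degree_le_1[OF perm] by simp
qed

end
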